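(* Let $p$ be an odd prime, let $n\ge 2$, and let $L=\theta^n+a_{n-1}(t)\theta^{n-1}+\cdots+a_1(t)\theta+a_0(t)$ with $a_i(t)\in\mathbb{Z}_p[[t]]$, $a_i(0)=0$ for $i=0,\ldots,n-1$, and $\theta=t\frac{d}{dt}$. Let $F_0,F_1\in\mathbb{Q}_p[[t]]$ be the power series such that $y_0=F_0$ and $y_1=F_0\log t+F_1$ are the first two elements of the standard basis of solutions of $L(y)=0$ (so $F_0(0)=1$, $F_1(0)=0$). Suppose that $L(y)=0$ has a $p$-adic Frobenius structure. Then $\exp(F_1/F_0)\in\mathbb{Z}_p[[t]]$.
   Context: Frobenius lift: $\sigma:\mathbb{Z}_p[[t]]\to\mathbb{Z}_p[[t]]$ is a fixed ring endomorphism of the form $h(t)\mapsto h^\sigma:=h(t^\sigma)$, where $t^\sigma=t^p(1+p\,t\,u(t))$ for some $u(t)\in\mathbb{Z}_p[[t]]$. The same substitution is applied to series in $\mathbb{Q}_p[[t]]$. Standard basis: since all $a_i(0)=0$ (MUM-type), $L(y)=0$ has a unique basis of solutions in $\mathbb{Q}_p[[t]][\log t]$ of the form $$y_i=F_0\frac{\log^i t}{i!}+F_1\frac{\log^{i-1}t}{(i-1)!}+\cdots+F_{i-1}\log t+F_i,\qquad i=0,\ldots,n-1,$$ with $F_i\in\mathbb{Q}_p[[t]]$, $F_0(0)=1$ and $F_i(0)=0$ for $i>0$. Solutions of $L(y)=0$ are the $\mathbb{Q}_p$-linear combinations of the $y_i$. The lift $\sigma$ is extended to solutions by $F_i^\sigma=F_i(t^\sigma)$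 and $\log t^\sigma=p\log t-\sum_{m\ge1}\frac1m(-p\,t\,u(t))^m$; one writes $y(t^\sigma)=y^\sigma$. Frobenius structure: $L(y)=0$ has a $p$-adic Frobenius structure (with respect to $\sigma$) if there is an operator $\mathcal{A}=\sum_{i=0}^{n-1}A_i(t)\theta^i\in\mathbb{Z}_p[[t]][\theta]$ with $A_0(0)=1$ such that for every solution $y(t)$ of $L(y)=0$ the composition $\mathcal{A}(y(t^\sigma))$ is again a solution of $L(y)=0$. *)

theory Defs
  imports
    "Berlekamp_Zassenhaus.Finite_Field"
    "HOL-Computational_Algebra.Computational_Algebra"
begin

section \<open>The $p$-adic integers and the $p$-adic numbers\<close>

text \<open>
  The prime $p$ is \<open>CARD('p)\<close> for an index type \<open>'p\<close> of class \<^class>\<open>prime_card\<close>.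
  The ring $\mathbb{Z}_p$ is the inverse limit of the rings $\mathbb{Z}/p^k$; the $k$-th component
  is represented by its residue in $\{0,\ldots,p^k-1\}$, which the defining equation enforces.
\<close>

typedef (overloaded) ('p::prime_card) padic_int =
  "{x :: nat \<Rightarrow> int. \<forall>k. x (Suc k) mod int CARD('p) ^ k = x k}"
  morphisms padic_residue Abs_padic_int
  by (rule exI[of _ "\<lambda>_. 0"]) simp

setup_lifting type_definition_padic_int

lemma prime_power_mod_Suc:
  "(z mod int CARD('p) ^ Suc k) mod int CARD('p::prime_card) ^ k = z mod int CARD('p) ^ k"
  by (rule mod_mod_cancel) (simp add: le_imp_power_dvd)

lemma padic_residue_mod_self:
  "padic_residue x k mod int CARD('p) ^ k = padic_residue (x :: 'p::prime_card padic_int) k"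
  by transfer (metis mod_mod_trivial)

lemma padic_residue_mod:
  assumes "k \<le> m"
  shows "padic_residue x m mod int CARD('p) ^ k = padic_residue (x :: 'p::prime_card padic_int) k"
  using assms
proof (induction m rule: dec_induct)
  case base
  show ?case by (rule padic_residue_mod_self)
next
  case (step m)
  have "padic_residue x (Suc m) mod int CARD('p) ^ m = padic_residue x m"
    by transfer simp
  moreover have "int CARD('p) ^ k dvd int CARD('p) ^ m"
    using step.hyps by (simp add: le_imp_power_dvd)
  ultimately show ?case
    using step.IH by (metis mod_mod_cancel)
qed

instantiation padic_int :: (prime_card) comm_ring_1
begin

lift_definition zero_padic_int :: "'a padic_int" is "\<lambda>_. 0"
  by simp

lift_definition one_padic_int :: "'a padic_int" is "\<lambda>k. 1 mod int CARD('a) ^ k"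
  by (simp only: prime_power_mod_Suc simp_thms)

lift_definition plus_padic_int :: "'a padic_int \<Rightarrow> 'a padic_int \<Rightarrow> 'a padic_int"
  is "\<lambda>x y k. (x k + y k) mod int CARD('a) ^ k"
  by (metis prime_power_mod_Suc mod_add_eq)

lift_definition uminus_padic_int :: "'a padic_int \<Rightarrow> 'a padic_int"
  is "\<lambda>x k. (- x k) mod int CARD('a) ^ k"
  by (metis prime_power_mod_Suc mod_minus_eq)

lift_definition minus_padic_int :: "'a padic_int \<Rightarrow> 'a padic_int \<Rightarrow> 'a padic_int"
  is "\<lambda>x y k. (x k - y k) mod int CARD('a) ^ k"
  by (metis prime_power_mod_Suc mod_diff_eq)

lift_definition times_padic_int :: "'a padic_int \<Rightarrow> 'a padic_int \<Rightarrow> 'a padic_int"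
  is "\<lambda>x y k. (x k * y k) mod int CARD('a) ^ k"
  by (metis prime_power_mod_Suc mod_mult_eq)

lemma padic_int_eqI:
  fixes x y :: "'a padic_int"
  assumes "\<And>k. padic_residue x k = padic_residue y k"
  shows "x = y"
  using assms by (simp add: padic_residue_inject[symmetric] fun_eq_iff)

instance
proof
  fix a b c :: "'a padic_int"
  note reps = zero_padic_int.rep_eq one_padic_int.rep_eq plus_padic_int.rep_eq
    uminus_padic_int.rep_eq minus_padic_int.rep_eq times_padic_int.rep_eq
  show "a * b * c = a * (b * c)"
    by (rule padic_int_eqI) (simp add: reps mod_simps algebra_simps)
  show "a * b = b * a"
    by (rule padic_int_eqI) (simp add: reps mult.commute)
  show "1 * a = a"
    by (rule padic_int_eqI) (simp add: reps mod_simps padic_residue_mod_self)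
  show "a + b + c = a + (b + c)"
    by (rule padic_int_eqI) (simp add: reps mod_simps algebra_simps)
  show "a + b = b + a"
    by (rule padic_int_eqI) (simp add: reps add.commute)
  show "0 + a = a"
    by (rule padic_int_eqI) (simp add: reps padic_residue_mod_self)
  show "- a + a = 0"
    by (rule padic_int_eqI) (simp add: reps mod_simps)
  show "a - b = a + - b"
    by (rule padic_int_eqI) (simp add: reps mod_simps)
  show "(a + b) * c = a * c + b * c"
    by (rule padic_int_eqI) (simp add: reps mod_simps algebra_simps)
  show "(0 :: 'a padic_int) \<noteq> 1"
  proof
    assume "(0 :: 'a padic_int) = 1"
    then have "padic_residue (0 :: 'a padic_int) 1 = padic_residue (1 :: 'a padic_int) 1"
      by simp
    moreover have "int CARD('a) > 1"
      using prime_gt_1_nat[OF prime_card[where 'a = 'a]] by simp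
    ultimately show False
      by (simp add: reps)
  qed
qed

end

lemma padic_residue_of_nat:
  "padic_residue (of_nat m :: 'p::prime_card padic_int) k = int m mod int CARD('p) ^ k"
  by (induction m)
    (simp_all add: zero_padic_int.rep_eq one_padic_int.rep_eq plus_padic_int.rep_eq mod_simps)

instance padic_int :: (prime_card) idom
proof
  fix x y :: "'a padic_int"
  let ?p = "int CARD('a)"
  have p: "prime ?p"
    using prime_card[where 'a = 'a] by simp
  assume "x \<noteq> 0" "y \<noteq> 0"
  then obtain k m where k: "padic_residue x k \<noteq> 0" and m: "padic_residue y m \<noteq> 0"
    by (metis padic_int_eqI zero_padic_int.rep_eq)
  define N where "N = k + m"
  define a where "a = padic_residue x N"
  define b where "b = padic_residue y N"
  have a: "\<not> ?p ^ k dvd a"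
    using k padic_residue_mod[of k N x] by (auto simp: N_def a_def)
  have b: "\<not> ?p ^ m dvd b"
    using m padic_residue_mod[of m N y] by (auto simp: N_def b_def)
  have nz: "a \<noteq> 0" "b \<noteq> 0"
    using a b by auto
  have "multiplicity ?p a < k" "multiplicity ?p b < m"
    using a b by (metis multiplicity_dvd' not_less)+
  then have "multiplicity ?p (a * b) < N"
    using p nz by (simp add: N_def prime_elem_multiplicity_mult_distrib)
  moreover have "\<not> is_unit ?p"
    using p not_prime_unit by blast
  ultimately have "\<not> ?p ^ N dvd a * b"
    using nz by (metis mult_eq_0_iff not_less power_dvd_iff_le_multiplicity)
  then have "padic_residue (x * y) N \<noteq> 0"
    by (auto simp: times_padic_int.rep_eq a_def b_def)
  then show "x * y \<noteq> 0"
    by (auto simp: zero_padic_int.rep_eq)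
qed

instance padic_int :: (prime_card) ring_char_0
proof
  show "inj (of_nat :: nat \<Rightarrow> 'a padic_int)"
  proof
    fix m n :: nat
    assume eq: "(of_nat m :: 'a padic_int) = of_nat n"
    have p: "CARD('a) > 1"
      using prime_gt_1_nat[OF prime_card[where 'a = 'a]] by simp
    define k where "k = m + n"
    have "k < CARD('a) ^ k"
      using p by (intro power_gt_expt) simp
    then have small: "m < CARD('a) ^ k" "n < CARD('a) ^ k"
      by (simp_all add: k_def)
    have "int m mod int CARD('a) ^ k = int n mod int CARD('a) ^ k"
      by (metis eq padic_residue_of_nat)
    then have "m mod CARD('a) ^ k = n mod CARD('a) ^ k"
      by (metis of_nat_eq_iff of_nat_mod of_nat_power)
    with small show "m = n"
      by simp
  qed
qed

instance fract :: ("{idom, ring_char_0}") ring_char_0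
  by standard (simp add: inj_on_def of_nat_fract eq_fract)

instance fract :: ("{idom, ring_char_0}") field_char_0 ..

type_synonym 'p padic = "'p padic_int fract"

definition padic_integers :: "'p::prime_card padic set" where
  "padic_integers = range to_fract"

definition integral_fps :: "'p::prime_card padic fps set" where
  "integral_fps = {f. \<forall>k. fps_nth f k \<in> padic_integers}"


section \<open>Power series in $t$ with powers of $\log t$\<close>

text \<open>
  The ring $\mathbb{Q}_p[[t]][\log t]$ is the polynomial ring over $\mathbb{Q}_p[[t]]$
  in the formal variable $\log t$. The derivation $\theta = t\,d/dt$ acts on coefficients as
  \<^const>\<open>fps_XD\<close>, and $\theta(\log t) = 1$.
\<close>

type_synonym 'p log_series = "'p padic fps poly"

definition log_t :: "'p::prime_card log_series" where
  "log_t = [:0, 1:]"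

definition theta :: "'p::prime_card log_series \<Rightarrow> 'p log_series" where
  "theta y = map_poly fps_XD y + pderiv y"

definition diff_op :: "nat \<Rightarrow> (nat \<Rightarrow> 'p::prime_card padic fps) \<Rightarrow> 'p log_series \<Rightarrow> 'p log_series"
  where "diff_op n A y = (\<Sum>i<n. smult (A i) ((theta ^^ i) y))"

definition monic_diff_op ::
    "nat \<Rightarrow> (nat \<Rightarrow> 'p::prime_card padic fps) \<Rightarrow> 'p log_series \<Rightarrow> 'p log_series"
  where "monic_diff_op n a y = (theta ^^ n) y + diff_op n a y"

definition is_solution :: "nat \<Rightarrow> (nat \<Rightarrow> 'p::prime_card padic fps) \<Rightarrow> 'p log_series \<Rightarrow> bool"
  where "is_solution n a y \<longleftrightarrow> monic_diff_op n a y = 0"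

definition log_solution :: "(nat \<Rightarrow> 'p::prime_card padic fps) \<Rightarrow> nat \<Rightarrow> 'p log_series" where
  "log_solution F i = (\<Sum>j\<le>i. smult (F j * fps_const (1 / fact (i - j))) (log_t ^ (i - j)))"

text \<open>
  The conditions below determine \<open>F 0, \<dots>, F (n - 1)\<close> uniquely when all \<open>a i\<close> vanish at \<open>0\<close>.
\<close>

definition standard_basis ::
    "nat \<Rightarrow> (nat \<Rightarrow> 'p::prime_card padic fps) \<Rightarrow> (nat \<Rightarrow> 'p padic fps) \<Rightarrow> bool"
  where "standard_basis n a F \<longleftrightarrow>
    (\<forall>i<n. is_solution n a (log_solution F i)) \<and>
    fps_nth (F 0) 0 = 1 \<and> (\<forall>i. 0 < i \<and> i < n \<longrightarrow> fps_nth (F i) 0 = 0)"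


section \<open>Frobenius lifts and Frobenius structures\<close>

definition ptu :: "'p::prime_card padic fps \<Rightarrow> 'p padic fps" where
  "ptu u = of_nat CARD('p) * fps_X * u"

definition t_sigma :: "'p::prime_card padic fps \<Rightarrow> 'p padic fps" where
  "t_sigma u = fps_X ^ CARD('p) * (1 + ptu u)"

text \<open>
  As \<^term>\<open>fps_ln 1\<close> is the series $\log(1+X) = -\sum_{m\ge1}\frac1m(-X)^m$, the second
  summand of $\log t^\sigma$ is $-\sum_{m\ge1}\frac1m(-p\,t\,u(t))^m$.
\<close>

definition log_t_sigma :: "'p::prime_card padic fps \<Rightarrow> 'p log_series" where
  "log_t_sigma u = of_nat CARD('p) * log_t + [:fps_ln 1 oo ptu u:]"

definition frobenius_lift :: "'p::prime_card padic fps \<Rightarrow> 'p log_series \<Rightarrow> 'p log_series" where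
  "frobenius_lift u y = pcompose (map_poly (\<lambda>f. f oo t_sigma u) y) (log_t_sigma u)"

definition has_frobenius_structure ::
    "'p::prime_card padic fps \<Rightarrow> nat \<Rightarrow> (nat \<Rightarrow> 'p padic fps) \<Rightarrow> bool"
  where "has_frobenius_structure u n a \<longleftrightarrow>
    (\<exists>A. (\<forall>i<n. A i \<in> integral_fps) \<and> fps_nth (A 0) 0 = 1 \<and>
      (\<forall>y. is_solution n a y \<longrightarrow> is_solution n a (diff_op n A (frobenius_lift u y))))"

end

theory Submission
  imports Defs
begin

text \<open>
  Write $g = F_1/F_0$ and $\mathcal{A}$ for the operator of the Frobenius structure. The proof
  derives the congruence $p\,g \equiv g^\sigma \pmod p$ from $\mathcal{A}$ and then applies Dwork's
  criterion, by which such a congruence makes $\exp(g)$ integral (\<open>dwork_exp_integral\<close>).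

  Solutions without logarithms are determined by their constant term, so
  $\mathcal{A}(F_0^\sigma) = F_0$. The solution $\mathcal{A}(y_1^\sigma)$ has the logarithmic part of
  $p\,y_1$, hence equals $p\,y_1 + c\,y_0$ with a constant $c$ divisible by $p$; comparing the terms free
  of $\log t$ gives $\mathcal{A}(F_1^\sigma) \equiv p\,F_1 \pmod p$ (\<open>frobenius_F1\<close>).
  Now $F_1^\sigma = F_0^\sigma g^\sigma$. If $\theta(g)$ is integral, then
  $\theta(g^\sigma)$ is divisible by $p$, because $\theta(t^\sigma)$ is; modulo $p$ the operator
  $\mathcal{A}$ therefore treats $g^\sigma$ as a constant, although $g$ itself may have denominators:
  \[ p\,F_1 \equiv \mathcal{A}(F_0^\sigma g^\sigma) \equiv g^\sigma \mathcal{A}(F_0^\sigma)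
     = g^\sigma F_0 \pmod p, \]
  and dividing by $F_0$ gives the congruence.

  The integrality of $F_0$ and of $\theta(g)$ that this uses comes from the same equations by
  induction on the degree: $t^\sigma$ is divisible by $t^p$, so a coefficient of $f^\sigma$ depends
  on coefficients of $f$ of lower degree only. Applying $\theta$ to $p\,g \equiv g^\sigma$, known up to
  some degree, yields $p\,\theta(g) \equiv 0 \pmod p$ there, and so the integrality of the next
  coefficient of $\theta(g)$.
\<close>

section \<open>Integers that are invertible in $\mathbb{Z}_p$\<close>

lemma padic_integers_of_nat [simp, intro]: "of_nat m \<in> (padic_integers :: 'p::prime_card padic set)"
  unfolding padic_integers_def by (metis of_nat_fract rangeI to_fract_def)

lemma padic_integers_0 [simp, intro]: "0 \<in> padic_integers"
  using padic_integers_of_nat[of 0] by simp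

lemma padic_integers_1 [simp, intro]: "1 \<in> padic_integers"
  using padic_integers_of_nat[of 1] by simp

lemma padic_integers_add [intro]:
  "x \<in> padic_integers \<Longrightarrow> y \<in> padic_integers \<Longrightarrow> x + y \<in> padic_integers"
  unfolding padic_integers_def by (auto simp flip: to_fract_add)

lemma padic_integers_mult [intro]:
  "x \<in> padic_integers \<Longrightarrow> y \<in> padic_integers \<Longrightarrow> x * y \<in> padic_integers"
  unfolding padic_integers_def by (auto simp flip: to_fract_mult)

lemma padic_integers_uminus [intro]: "x \<in> padic_integers \<Longrightarrow> - x \<in> padic_integers"
  unfolding padic_integers_def by (auto simp flip: to_fract_uminus)

lemma padic_integers_diff [intro]:
  "x \<in> padic_integers \<Longrightarrow> y \<in> padic_integers \<Longrightarrow> x - y \<in> padic_integers"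
  using padic_integers_add[of x "- y"] by auto

lemma padic_integers_power [intro]: "x \<in> padic_integers \<Longrightarrow> x ^ k \<in> padic_integers"
  by (induction k) auto

lemma padic_integers_sum [intro]:
  "(\<And>i. i \<in> A \<Longrightarrow> f i \<in> padic_integers) \<Longrightarrow> sum f A \<in> padic_integers"
  by (induction A rule: infinite_finite_induct) auto

text \<open>
  The residues of $1/m$ are the inverses of $m$ modulo the powers of $p$; uniqueness of inverses
  makes them compatible.
\<close>

lemma of_nat_padic_int_invertible:
  assumes "\<not> CARD('p) dvd m"
  obtains x :: "'p::prime_card padic_int" where "of_nat m * x = 1"
proof -
  let ?p = "int CARD('p)"
  have cop: "coprime (int m) (?p ^ k)" for k
    using assms prime_card[where 'a = 'p]
    by (metis coprime_commute coprime_int_iff coprime_power_right_iff of_nat_power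
        prime_imp_coprime coprime_power_left_iff)
  have ppos: "?p ^ k > 0" for k
    using prime_gt_0_nat[OF prime_card[where 'a = 'p]] by simp
  have "\<exists>z. int m * z mod ?p ^ k = 1 mod ?p ^ k" for k
    using cong_solve_coprime_int[OF cop[of k]] by (auto simp: cong_def)
  then obtain z where z: "\<And>k. int m * z k mod ?p ^ k = 1 mod ?p ^ k"
    by metis
  define x where "x = (\<lambda>k. z k mod ?p ^ k)"
  have x: "int m * x k mod ?p ^ k = 1 mod ?p ^ k" for k
    unfolding x_def using z[of k] by (simp add: mod_simps)
  have compat: "x (Suc k) mod ?p ^ k = x k" for k
  proof -
    have "int m * x (Suc k) mod ?p ^ k = (int m * x (Suc k) mod ?p ^ Suc k) mod ?p ^ k"
      by (simp only: prime_power_mod_Suc)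
    also have "\<dots> = 1 mod ?p ^ k"
      by (simp only: x prime_power_mod_Suc)
    finally have "[int m * x (Suc k) = int m * x k] (mod ?p ^ k)"
      using x[of k] by (simp add: cong_def)
    then have "[x (Suc k) = x k] (mod ?p ^ k)"
      using cop[of k] by (simp add: cong_mult_lcancel)
    then show ?thesis
      by (simp add: cong_def x_def)
  qed
  define X :: "'p padic_int" where "X = Abs_padic_int x"
  have X: "padic_residue X k = x k" for k
    unfolding X_def using compat by (subst Abs_padic_int_inverse) auto
  have "of_nat m * X = 1"
    by (rule padic_int_eqI)
      (use x in \<open>simp add: times_padic_int.rep_eq one_padic_int.rep_eq padic_residue_of_nat X mod_simps\<close>)
  then show thesis
    by (rule that)
qed

lemma padic_integers_inverse_of_nat:
  assumes "\<not> CARD('p) dvd m"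
  shows "1 / of_nat m \<in> (padic_integers :: 'p::prime_card padic set)"
proof -
  obtain x :: "'p padic_int" where x: "of_nat m * x = 1"
    using of_nat_padic_int_invertible[OF assms] .
  have "of_nat m * to_fract x = 1"
    by (metis of_nat_fract to_fract_def to_fract_mult to_fract_1 x)
  then have "1 / of_nat m = to_fract x"
    by (metis mult.commute mult_zero_left nonzero_eq_divide_eq zero_neq_one)
  then show ?thesis
    by (auto simp: padic_integers_def)
qed

lemma multiplicity_fact_prime:
  assumes "prime (p :: nat)"
  shows "multiplicity p (fact m) = m div p + multiplicity p (fact (m div p))"
proof (induction m)
  case 0
  then show ?case by simp
next
  case (Suc m)
  have pe: "prime_elem p" and p0: "p > 0"
    using assms prime_gt_0_nat by auto
  have mult_fact: "multiplicity p (fact (Suc k)) = multiplicity p (Suc k) + multiplicity p (fact k)" for k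
    unfolding fact_Suc using pe by (subst prime_elem_multiplicity_mult_distrib) auto
  show ?case
  proof (cases "p dvd Suc m")
    case True
    then obtain q where q: "Suc m = p * q"
      by auto
    then have "q > 0" by (cases q) auto
    have div: "Suc m div p = Suc (m div p)"
      using True by (simp add: div_Suc dvd_eq_mod_eq_0)
    then have q': "q = Suc (m div p)"
      using q p0 by simp
    have "multiplicity p (Suc m) = Suc (multiplicity p q)"
      unfolding q using \<open>q > 0\<close> assms p0
      by (subst multiplicity_times_same) auto
    then show ?thesis
      using Suc.IH unfolding mult_fact div q' by simp
  next
    case False
    then have "Suc m div p = m div p"
      by (simp add: div_Suc dvd_eq_mod_eq_0)
    with False Suc.IH show ?thesis
      by (simp add: mult_fact not_dvd_imp_multiplicity_0 del: fact_Suc)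
  qed
qed

lemma multiplicity_fact_prime_less:
  assumes "prime (p :: nat)" "m > 0"
  shows "multiplicity p (fact m) < m"
  using assms(2)
proof (induction m rule: less_induct)
  case (less m)
  have p: "p \<ge> 2"
    using assms(1) prime_ge_2_nat by blast
  show ?case
  proof (cases "m div p = 0")
    case True
    then show ?thesis
      using less.prems by (simp add: multiplicity_fact_prime[OF assms(1), of m])
  next
    case False
    have "2 * (m div p) \<le> p * (m div p)"
      using p by simp
    also have "\<dots> \<le> m"
      by simp
    finally have "2 * (m div p) \<le> m" .
    moreover have "multiplicity p (fact (m div p)) < m div p"
      using False p less.prems by (intro less.IH) auto
    ultimately show ?thesis
      by (simp add: multiplicity_fact_prime[OF assms(1), of m])
  qed
qed

text \<open>
  This bound on the denominators of the exponential series also bounds those of the logarithm,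
  as \<open>p ^ m / Suc m = fact m * (p ^ m / fact (Suc m))\<close>.
\<close>

lemma prime_power_over_fact_integral:
  "of_nat CARD('p::prime_card) ^ m / fact (Suc m) \<in> (padic_integers :: 'p padic set)"
proof -
  let ?p = "CARD('p)"
  have p: "prime ?p"
    by (rule prime_card)
  define v where "v = multiplicity ?p (fact (Suc m))"
  have "v \<le> m"
    using multiplicity_fact_prime_less[OF p, of "Suc m"] unfolding v_def by simp
  have "\<not> is_unit ?p" "(fact (Suc m) :: nat) \<noteq> 0"
    using p not_prime_unit by blast (rule fact_nonzero)
  then obtain r where r: "fact (Suc m) = ?p ^ v * r" "\<not> ?p dvd r"
    using multiplicity_decompose'[of "fact (Suc m)" ?p] unfolding v_def by metis
  have "(fact (Suc m) :: 'p padic) = of_nat ?p ^ v * of_nat r"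
    by (metis of_nat_fact of_nat_mult of_nat_power r(1))
  moreover have "(of_nat ?p :: 'p padic) ^ m = of_nat ?p ^ v * of_nat ?p ^ (m - v)"
    using \<open>v \<le> m\<close> by (simp flip: power_add)
  moreover have "(of_nat ?p :: 'p padic) \<noteq> 0"
    using p by (simp add: prime_gt_0_nat)
  ultimately have "of_nat ?p ^ m / fact (Suc m) = (of_nat ?p ^ (m - v) * (1 / of_nat r) :: 'p padic)"
    by simp
  also have "\<dots> \<in> padic_integers"
    by (intro padic_integers_mult padic_integers_power padic_integers_of_nat
        padic_integers_inverse_of_nat r(2))
  finally show ?thesis .
qed

section \<open>The Frobenius map of the residue field\<close>

lemma padic_residue_power:
  "padic_residue (x ^ m) k = padic_residue (x :: 'p::prime_card padic_int) k ^ m mod int CARD('p) ^ k"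
  by (induction m)
    (simp_all add: one_padic_int.rep_eq times_padic_int.rep_eq mod_simps)

text \<open>
  Dividing the residues of \<open>x\<close> by \<open>p\<close> loses one digit, so the quotient modulo \<open>p ^ k\<close> is read
  off from \<open>x\<close> modulo \<open>p ^ (k + 1)\<close>.
\<close>

lemma padic_int_dvd_of_residue_eq_0:
  fixes x :: "'p::prime_card padic_int"
  assumes "padic_residue x 1 = 0"
  shows "of_nat CARD('p) dvd x"
proof -
  let ?p = "int CARD('p)"
  have p0: "?p > 0"
    using prime_gt_0_nat[OF prime_card[where 'a = 'p]] by simp
  define z where "z = (\<lambda>k. padic_residue x (Suc k) div ?p)"
  have z: "padic_residue x (Suc k) = ?p * z k" for k
    using padic_residue_mod[of 1 "Suc k" x] assms by (auto simp: z_def)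
  have "z (Suc k) mod ?p ^ k = z k" for k
  proof -
    have "?p * (z (Suc k) mod ?p ^ k) = padic_residue x (Suc (Suc k)) mod ?p ^ Suc k"
      unfolding z mult_mod_right by simp
    also have "\<dots> = ?p * z k"
      using padic_residue_mod[of "Suc k" "Suc (Suc k)" x] z[of k] by simp
    finally show ?thesis
      using p0 by simp
  qed
  then have Z: "padic_residue (Abs_padic_int z :: 'p padic_int) k = z k" for k
    by (subst Abs_padic_int_inverse) auto
  have "of_nat CARD('p) * Abs_padic_int z = x"
  proof (rule padic_int_eqI)
    fix k
    have "padic_residue (of_nat CARD('p) * Abs_padic_int z :: 'p padic_int) k = ?p * z k mod ?p ^ k"
      by (simp add: times_padic_int.rep_eq padic_residue_of_nat Z mod_simps)
    also have "\<dots> = padic_residue x k"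
      using padic_residue_mod[of k "Suc k" x] by (simp add: z)
    finally show "padic_residue (of_nat CARD('p) * Abs_padic_int z :: 'p padic_int) k = padic_residue x k" .
  qed
  then show ?thesis
    by (metis dvd_triv_left)
qed

text \<open>
  This is where it matters that the residue field is \<open>\<F>\<^sub>p\<close>: its Frobenius map is the identity.
\<close>

lemma padic_fermat:
  assumes "x \<in> (padic_integers :: 'p::prime_card padic set)"
  obtains z where "z \<in> padic_integers" "x ^ CARD('p) - x = of_nat CARD('p) * z"
proof -
  let ?p = "CARD('p)"
  obtain y :: "'p padic_int" where y: "x = to_fract y"
    using assms by (auto simp: padic_integers_def)
  define r where "r = nat (padic_residue y 1)"
  have "padic_residue y 1 \<ge> 0"
    using padic_residue_mod_self[of y 1] prime_gt_0_nat[OF prime_card[where 'a = 'p]]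
    by (metis of_nat_0_less_iff pos_mod_sign power_one_right)
  then have r: "padic_residue y 1 = int r"
    by (simp add: r_def)
  have "[r ^ ?p = r] (mod ?p)"
  proof (cases "?p dvd r")
    case True
    moreover have "?p dvd r ^ ?p"
      using True prime_gt_0_nat[OF prime_card[where 'a = 'p]] by (metis dvd_power dvd_trans)
    ultimately show ?thesis
      by (simp add: cong_def mod_eq_0_iff_dvd)
  next
    case False
    have "[r * r ^ (?p - 1) = r * 1] (mod ?p)"
      by (intro cong_mult fermat_theorem prime_card False cong_refl)
    moreover have "r * r ^ (?p - 1) = r ^ ?p"
      using prime_gt_0_nat[OF prime_card[where 'a = 'p]] by (simp add: power_eq_if)
    ultimately show ?thesis
      by simp
  qed
  then have "[int r ^ ?p = int r] (mod int ?p)"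
    by (metis cong_int_iff of_nat_power)
  then have "int ?p dvd int r ^ ?p - int r"
    by (simp add: cong_iff_dvd_diff)
  then have "padic_residue (y ^ ?p - y) 1 = 0"
    unfolding minus_padic_int.rep_eq padic_residue_power r by (simp add: mod_diff_left_eq)
  then obtain w where w: "y ^ ?p - y = of_nat ?p * w"
    using padic_int_dvd_of_residue_eq_0 by (metis dvdE)
  have to_fract_power: "to_fract (y ^ m) = to_fract y ^ m" for m
    by (induction m) auto
  have "x ^ ?p - x = to_fract (y ^ ?p - y)"
    by (simp add: y to_fract_power)
  also have "\<dots> = of_nat ?p * to_fract w"
    by (simp add: w of_nat_fract to_fract_def)
  finally show thesis
    by (intro that[of "to_fract w"]) (auto simp: padic_integers_def)
qed

section \<open>Power series that are integral up to a given degree\<close>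

text \<open>
  All integrality proofs below go coefficient by coefficient, so integrality and congruences
  modulo $p$ are needed up to a degree only. One notion covers both: for \<open>c = 1\<close> it is integrality
  modulo $t^k$, for \<open>c = p\<close> congruence to \<open>0\<close> modulo $p$.
\<close>

definition multiple_below :: "'p::prime_card padic \<Rightarrow> nat \<Rightarrow> 'p padic fps \<Rightarrow> bool" where
  "multiple_below c k f \<longleftrightarrow> (\<forall>j<k. \<exists>z\<in>padic_integers. fps_nth f j = c * z)"

lemma multiple_belowI:
  "(\<And>j. j < k \<Longrightarrow> \<exists>z\<in>padic_integers. fps_nth f j = c * z) \<Longrightarrow> multiple_below c k f"
  by (simp add: multiple_below_def)

lemma multiple_belowE:
  assumes "multiple_below c k f" "j < k"
  obtains z where "z \<in> padic_integers" "fps_nth f j = c * z"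
  using assms by (auto simp: multiple_below_def)

lemma multiple_below_obtain:
  assumes "multiple_below c k f"
  obtains z where "\<And>j. z j \<in> padic_integers" "\<And>j. j < k \<Longrightarrow> fps_nth f j = c * z j"
proof -
  have "\<exists>z. \<forall>j. z j \<in> padic_integers \<and> (j < k \<longrightarrow> fps_nth f j = c * z j)"
    using assms unfolding multiple_below_def by (intro choice) (metis padic_integers_0)
  then show thesis
    using that by blast
qed

lemma integral_fps_iff_multiple_below: "f \<in> integral_fps \<longleftrightarrow> (\<forall>k. multiple_below 1 k f)"
  unfolding integral_fps_def multiple_below_def by (auto intro: lessI)

lemma multiple_below_integral_fps: "f \<in> integral_fps \<Longrightarrow> multiple_below 1 k f"
  by (simp add: integral_fps_iff_multiple_below)

lemma multiple_below_mono: "multiple_below c k f \<Longrightarrow> l \<le> k \<Longrightarrow> multiple_below c l f"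
  by (auto simp: multiple_below_def)

lemma multiple_below_add:
  "multiple_below c k f \<Longrightarrow> multiple_below c k g \<Longrightarrow> multiple_below c k (f + g)"
  unfolding multiple_below_def by (metis fps_add_nth distrib_left padic_integers_add)

lemma multiple_below_uminus: "multiple_below c k f \<Longrightarrow> multiple_below c k (- f)"
  unfolding multiple_below_def by (metis fps_neg_nth mult_minus_right padic_integers_uminus)

lemma multiple_below_diff:
  "multiple_below c k f \<Longrightarrow> multiple_below c k g \<Longrightarrow> multiple_below c k (f - g)"
  using multiple_below_add[of c k f "- g"] multiple_below_uminus[of c k g] by simp

lemma multiple_below_0: "multiple_below c k 0"
  unfolding multiple_below_def by (metis fps_zero_nth mult_zero_right padic_integers_0)

lemma multiple_below_sum:
  "(\<And>i. i \<in> A \<Longrightarrow> multiple_below c k (f i)) \<Longrightarrow> multiple_below c k (sum f A)"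
  by (induction A rule: infinite_finite_induct) (auto intro: multiple_below_0 multiple_below_add)

lemma multiple_below_mult:
  assumes "multiple_below c k f" "multiple_below d k g"
  shows "multiple_below (c * d) k (f * g)"
proof (rule multiple_belowI)
  fix j assume "j < k"
  obtain x where x: "\<And>j. x j \<in> padic_integers" "\<And>j. j < k \<Longrightarrow> fps_nth f j = c * x j"
    using multiple_below_obtain[OF assms(1)] by blast
  obtain y where y: "\<And>j. y j \<in> padic_integers" "\<And>j. j < k \<Longrightarrow> fps_nth g j = d * y j"
    using multiple_below_obtain[OF assms(2)] by blast
  have "fps_nth (f * g) j = (\<Sum>i=0..j. (c * x i) * (d * y (j - i)))"
    unfolding fps_mult_nth using \<open>j < k\<close> x(2) y(2) by (intro sum.cong) auto
  also have "\<dots> = c * d * (\<Sum>i=0..j. x i * y (j - i))"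
    by (simp add: sum_distrib_left algebra_simps)
  finally show "\<exists>z\<in>padic_integers. fps_nth (f * g) j = c * d * z"
    using x(1) y(1) by blast
qed

lemma multiple_below_mult_integral:
  "multiple_below 1 k f \<Longrightarrow> multiple_below c k g \<Longrightarrow> multiple_below c k (f * g)"
  using multiple_below_mult[of 1 k f c g] by simp

lemma multiple_below_const: "x \<in> padic_integers \<Longrightarrow> multiple_below 1 k (fps_const x)"
  by (auto simp: multiple_below_def)

lemma multiple_below_1: "multiple_below 1 k 1"
  using multiple_below_const[of 1 k] by simp

lemma multiple_below_of_nat: "multiple_below 1 k (of_nat m)"
  using multiple_below_const[of "of_nat m" k] by (simp add: fps_of_nat)

lemma multiple_below_X: "multiple_below 1 k fps_X"
  by (auto simp: multiple_below_def fps_X_def)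

lemma multiple_below_power: "multiple_below 1 k f \<Longrightarrow> multiple_below 1 k (f ^ m)"
  by (induction m) (auto intro: multiple_below_1 multiple_below_mult_integral)

lemma multiple_below_of_nat_mult:
  "multiple_below c k f \<Longrightarrow> multiple_below (of_nat m * c) k (of_nat m * f)"
  by (rule multiple_below_mult) (auto simp: multiple_below_def fps_of_nat[symmetric])

lemma multiple_below_of_nat_multI: "multiple_below 1 k f \<Longrightarrow> multiple_below (of_nat m) k (of_nat m * f)"
  using multiple_below_of_nat_mult[of 1 k f m] by simp

lemma multiple_below_of_nat_multD:
  assumes "multiple_below (of_nat m) k (of_nat m * f)" "m > 0"
  shows "multiple_below 1 k f"
  using assms by (auto simp: multiple_below_def fps_of_nat[symmetric])

lemma of_nat_mult_fps_const_inverse: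
  assumes "m > 0"
  shows "of_nat m * (fps_const (1 / of_nat m) * f) = (f :: 'a::field_char_0 fps)"
  using assms by (simp add: fps_eq_iff fps_of_nat[symmetric])

lemma multiple_below_of_nat_imp_integral:
  "multiple_below (of_nat m) k f \<Longrightarrow> multiple_below 1 k f"
  unfolding multiple_below_def by (metis mult_1 padic_integers_mult padic_integers_of_nat)

lemma multiple_below_X_power_mult:
  assumes "multiple_below c k f"
  shows "multiple_below c (m + k) (fps_X ^ m * f)"
proof (rule multiple_belowI)
  fix j assume "j < m + k"
  show "\<exists>z\<in>padic_integers. fps_nth (fps_X ^ m * f) j = c * z"
  proof (cases "j < m")
    case True
    then show ?thesis
      by (auto simp: fps_X_power_mult_nth intro!: bexI[of _ 0])
  next
    case False
    then have "j - m < k"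
      using \<open>j < m + k\<close> by simp
    then obtain z where "z \<in> padic_integers" "fps_nth f (j - m) = c * z"
      using multiple_belowE[OF assms] by blast
    then show ?thesis
      using False by (auto simp: fps_X_power_mult_nth)
  qed
qed

lemma multiple_below_XD: "multiple_below c k f \<Longrightarrow> multiple_below c k (fps_XD f)"
  unfolding multiple_below_def
  by (metis fps_XD_nth mult.left_commute padic_integers_mult padic_integers_of_nat)

lemma multiple_below_XD_iterate: "multiple_below c k f \<Longrightarrow> multiple_below c k ((fps_XD ^^ i) f)"
  by (induction i) (auto intro: multiple_below_XD)

lemma multiple_below_compose:
  assumes "multiple_below c k f" "multiple_below 1 k s"
  shows "multiple_below c k (f oo s)"
proof (rule multiple_belowI)
  fix j assume "j < k"
  obtain x where x: "\<And>j. x j \<in> padic_integers" "\<And>j. j < k \<Longrightarrow> fps_nth f j = c * x j"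
    using multiple_below_obtain[OF assms(1)] by blast
  have s: "fps_nth (s ^ i) j \<in> padic_integers" for i
    using multiple_belowE[OF multiple_below_power[OF assms(2)] \<open>j < k\<close>] by (metis mult_1)
  have "fps_nth (f oo s) j = (\<Sum>i=0..j. (c * x i) * fps_nth (s ^ i) j)"
    unfolding fps_compose_nth using \<open>j < k\<close> x(2) by (intro sum.cong) auto
  also have "\<dots> = c * (\<Sum>i=0..j. x i * fps_nth (s ^ i) j)"
    by (simp add: sum_distrib_left algebra_simps)
  finally show "\<exists>z\<in>padic_integers. fps_nth (f oo s) j = c * z"
    using x(1) s by blast
qed

lemma multiple_below_cancel_factor:
  assumes "multiple_below 1 k f" "fps_nth f 0 = 1" "multiple_below c k (f * g)"
  shows "multiple_below c k g"
proof (rule multiple_belowI)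
  fix j assume "j < k"
  then show "\<exists>z\<in>padic_integers. fps_nth g j = c * z"
  proof (induction j rule: less_induct)
    case (less j)
    have "multiple_below c j g"
      using less by (intro multiple_belowI) auto
    then obtain y where y: "\<And>i. y i \<in> padic_integers" "\<And>i. i < j \<Longrightarrow> fps_nth g i = c * y i"
      using multiple_below_obtain by blast
    obtain x where x: "\<And>i. x i \<in> padic_integers" "\<And>i. i < k \<Longrightarrow> fps_nth f i = 1 * x i"
      using multiple_below_obtain[OF assms(1)] by blast
    obtain z where z: "z \<in> padic_integers" "fps_nth (f * g) j = c * z"
      using multiple_belowE[OF assms(3) less.prems] .
    have "fps_nth (f * g) j = fps_nth g j + (\<Sum>i=1..j. fps_nth f i * fps_nth g (j - i))"
      unfolding fps_mult_nth using assms(2) by (simp add: sum.atLeast_Suc_atMost)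
    also have "(\<Sum>i=1..j. fps_nth f i * fps_nth g (j - i)) = (\<Sum>i=1..j. x i * (c * y (j - i)))"
      using x(2) y(2) less.prems by (intro sum.cong) auto
    also have "\<dots> = c * (\<Sum>i=1..j. x i * y (j - i))"
      by (simp add: sum_distrib_left algebra_simps)
    finally have "fps_nth g j = c * (z - (\<Sum>i=1..j. x i * y (j - i)))"
      using z(2) by (simp add: algebra_simps)
    moreover have "z - (\<Sum>i=1..j. x i * y (j - i)) \<in> padic_integers"
      using x(1) y(1) z(1) by blast
    ultimately show ?case
      by blast
  qed
qed

text \<open>
  The factor $p^i$ in the \<open>i\<close>-th power of \<open>p h\<close> pays for the denominator of the \<open>i\<close>-th
  coefficient of the outer series; this is how logarithm and exponential become integral.
\<close>

lemma multiple_below_compose_of_nat_mult: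
  assumes "\<And>i. \<exists>z\<in>padic_integers. fps_nth f i * of_nat m ^ i = c * z"
    and "multiple_below 1 k h"
  shows "multiple_below c k (f oo (of_nat m * h))"
proof (rule multiple_belowI)
  fix j assume "j < k"
  obtain x where x: "\<And>i. x i \<in> padic_integers" "\<And>i. fps_nth f i * of_nat m ^ i = c * x i"
    using assms(1) by metis
  have h: "fps_nth (h ^ i) j \<in> padic_integers" for i
    using multiple_belowE[OF multiple_below_power[OF assms(2)] \<open>j < k\<close>] by (metis mult_1)
  have "fps_nth (f oo (of_nat m * h)) j =
      (\<Sum>i=0..j. fps_nth f i * of_nat m ^ i * fps_nth (h ^ i) j)"
    by (simp add: fps_compose_nth power_mult_distrib fps_of_nat[symmetric] mult.assoc)
  also have "\<dots> = c * (\<Sum>i=0..j. x i * fps_nth (h ^ i) j)"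
    by (simp add: x(2) sum_distrib_left mult.assoc)
  finally show "\<exists>z\<in>padic_integers. fps_nth (f oo (of_nat m * h)) j = c * z"
    using x(1) h by blast
qed

lemma multiple_below_ln:
  assumes "multiple_below 1 k h"
  shows "multiple_below (of_nat CARD('p)) k (fps_ln 1 oo (of_nat CARD('p) * h :: 'p::prime_card padic fps))"
proof (rule multiple_below_compose_of_nat_mult[OF _ assms])
  fix i
  let ?p = "of_nat CARD('p) :: 'p padic"
  show "\<exists>z\<in>padic_integers. fps_nth (fps_ln 1) i * ?p ^ i = ?p * z"
  proof (cases i)
    case 0
    then show ?thesis
      by (auto intro!: bexI[of _ 0])
  next
    case (Suc m)
    have "fps_nth (fps_ln 1) i * ?p ^ i = ?p * ((- 1) ^ m * (of_nat (fact m) * (?p ^ m / fact (Suc m))))"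
      by (simp add: Suc fps_ln_nth fact_Suc del: of_nat_Suc)
    moreover have "(- 1) ^ m * (of_nat (fact m) * (?p ^ m / fact (Suc m))) \<in> padic_integers"
      by (intro padic_integers_mult padic_integers_power padic_integers_uminus padic_integers_1
          padic_integers_of_nat prime_power_over_fact_integral)
    ultimately show ?thesis
      by blast
  qed
qed

lemma multiple_below_exp_minus_1:
  assumes "multiple_below 1 k h"
  shows "multiple_below (of_nat CARD('p)) k ((fps_exp 1 oo (of_nat CARD('p) * h)) - (1 :: 'p::prime_card padic fps))"
proof -
  let ?p = "of_nat CARD('p) :: 'p padic"
  have "multiple_below ?p k ((fps_exp 1 - 1) oo (of_nat CARD('p) * h))"
  proof (rule multiple_below_compose_of_nat_mult[OF _ assms])
    fix i
    show "\<exists>z\<in>padic_integers. fps_nth (fps_exp 1 - 1) i * ?p ^ i = ?p * z"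
    proof (cases i)
      case 0
      then show ?thesis
        by (auto intro!: bexI[of _ 0])
    next
      case (Suc m)
      have "fps_nth (fps_exp 1 - 1) i * ?p ^ i = ?p * (?p ^ m / fact (Suc m))"
        by (simp add: Suc del: fact_Suc)
      then show ?thesis
        using prime_power_over_fact_integral by blast
    qed
  qed
  then show ?thesis
    by (simp add: fps_compose_sub_distrib)
qed

section \<open>Substitution of $t^\<sigma>$\<close>

lemma t_sigma_nth_0 [simp]: "fps_nth (t_sigma (u :: 'p::prime_card padic fps)) 0 = 0"
  using prime_gt_0_nat[OF prime_card[where 'a = 'p]]
  by (simp add: t_sigma_def fps_X_power_mult_nth)

lemma multiple_below_ptu:
  assumes "u \<in> integral_fps"
  shows "multiple_below (of_nat CARD('p)) k (ptu (u :: 'p::prime_card padic fps))"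
  unfolding ptu_def mult.assoc
  using assms by (intro multiple_below_of_nat_multI multiple_below_mult_integral multiple_below_X
      multiple_below_integral_fps)

lemma multiple_below_1_plus_ptu: "u \<in> integral_fps \<Longrightarrow> multiple_below 1 k (1 + ptu u)"
  by (intro multiple_below_add multiple_below_1 multiple_below_of_nat_imp_integral[OF multiple_below_ptu])

lemma multiple_below_t_sigma: "u \<in> integral_fps \<Longrightarrow> multiple_below 1 k (t_sigma u)"
  unfolding t_sigma_def
  by (intro multiple_below_mult_integral multiple_below_power multiple_below_X multiple_below_1_plus_ptu)

text \<open>
  As $t^\<sigma>$ is divisible by $t^p$, the coefficients of $f^\<sigma>$ up to a positive degree \<open>k\<close> involve
  only coefficients of \<open>f\<close> of degree less than \<open>k\<close>. This gain of a degree drives every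
  induction on coefficients below.
\<close>

lemma multiple_below_sigma_gain:
  assumes u: "u \<in> integral_fps" and f: "multiple_below c k f" and f0: "multiple_below c 1 f"
  shows "multiple_below c (Suc k) (f oo t_sigma (u :: 'p::prime_card padic fps))"
proof -
  let ?p = "CARD('p)" and ?s = "t_sigma u"
  define g where "g = fps_shift 1 f"
  have f_eq: "f = fps_const (fps_nth f 0) + fps_X * g"
    by (rule fps_ext) (simp add: g_def)
  have "multiple_below c (k - 1) g"
    using f unfolding g_def multiple_below_def by auto
  then have "multiple_below c (k - 1) ((1 + ptu u) * (g oo ?s))"
    using u by (intro multiple_below_mult_integral multiple_below_1_plus_ptu multiple_below_compose
        multiple_below_t_sigma)
  then have "multiple_below c (?p + (k - 1)) (fps_X ^ ?p * ((1 + ptu u) * (g oo ?s)))"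
    by (rule multiple_below_X_power_mult)
  then have "multiple_below c (Suc k) (fps_X ^ ?p * ((1 + ptu u) * (g oo ?s)))"
    using prime_ge_2_nat[OF prime_card[where 'a = 'p]] by (elim multiple_below_mono) linarith
  moreover have "multiple_below c (Suc k) (fps_const (fps_nth f 0))"
    using f0 by (auto simp: multiple_below_def intro: bexI[of _ 0])
  ultimately have "multiple_below c (Suc k)
      (fps_const (fps_nth f 0) + fps_X ^ ?p * ((1 + ptu u) * (g oo ?s)))"
    by (intro multiple_below_add)
  also have "fps_const (fps_nth f 0) + fps_X ^ ?p * ((1 + ptu u) * (g oo ?s)) =
      fps_const (fps_nth f 0) + ?s * (g oo ?s)"
    by (simp add: t_sigma_def mult.assoc)
  also have "\<dots> = (fps_const (fps_nth f 0) + fps_X * g) oo ?s"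
    by (simp add: fps_compose_add_distrib fps_compose_mult_distrib fps_X_fps_compose_startby0)
  also have "\<dots> = f oo ?s"
    by (simp only: f_eq[symmetric])
  finally show ?thesis .
qed

lemma fps_XD_mult: "fps_XD (f * g) = f * fps_XD g + fps_XD f * (g :: 'a::comm_ring_1 fps)"
  by (simp add: fps_XD_def algebra_simps)

lemma fps_XD_X_power: "fps_XD (fps_X ^ m) = of_nat m * (fps_X ^ m :: 'a::comm_ring_1 fps)"
  by (rule fps_ext) (simp add: fps_of_nat[symmetric])

text \<open>
  Differentiation turns the substitution into a multiple of $p$, because
  $\theta(t^\<sigma>)$ is $p\,t^p$ times an integral series.
\<close>

lemma multiple_below_XD_sigma_gain:
  assumes u: "u \<in> integral_fps" and f: "multiple_below 1 k (fps_XD f)"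
  shows "multiple_below (of_nat CARD('p)) (Suc k) (fps_XD (f oo t_sigma (u :: 'p::prime_card padic fps)))"
proof -
  let ?p = "CARD('p)" and ?s = "t_sigma u"
  define w where "w = 1 + ptu u + fps_XD (fps_X * u)"
  have w: "multiple_below 1 l w" for l
    unfolding w_def using u
    by (intro multiple_below_add multiple_below_1_plus_ptu multiple_below_XD
        multiple_below_mult_integral multiple_below_X multiple_below_integral_fps)
  have "fps_XD (ptu u) = of_nat ?p * fps_XD (fps_X * u)"
    unfolding ptu_def mult.assoc fps_of_nat[symmetric] by simp
  then have XD_s: "fps_XD ?s = of_nat ?p * (fps_X ^ ?p * w)"
    by (simp add: t_sigma_def fps_XD_mult fps_XD_X_power w_def algebra_simps)
  have "fps_XD (f oo ?s) = (fps_deriv f oo ?s) * fps_XD ?s"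
    by (simp add: fps_XD_def fps_compose_deriv)
  then have eq: "fps_XD (f oo ?s) = of_nat ?p * (fps_X ^ ?p * (w * (fps_deriv f oo ?s)))"
    by (simp add: XD_s algebra_simps)
  have "multiple_below 1 (k - 1) (fps_deriv f)"
  proof (rule multiple_belowI)
    fix j assume "j < k - 1"
    then have "Suc j < k" by simp
    then show "\<exists>z\<in>padic_integers. fps_nth (fps_deriv f) j = 1 * z"
      using f unfolding multiple_below_def by fastforce
  qed
  then have "multiple_below 1 (?p + (k - 1)) (fps_X ^ ?p * (w * (fps_deriv f oo ?s)))"
    using u w by (intro multiple_below_X_power_mult multiple_below_mult_integral multiple_below_compose
        multiple_below_t_sigma)
  then have "multiple_below 1 (Suc k) (fps_X ^ ?p * (w * (fps_deriv f oo ?s)))"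
    using prime_ge_2_nat[OF prime_card[where 'a = 'p]] by (elim multiple_below_mono) linarith
  then show ?thesis
    unfolding eq by (rule multiple_below_of_nat_multI)
qed

section \<open>Dwork's criterion for the integrality of an exponential\<close>

lemma multiple_below_freshmans_dream:
  assumes "multiple_below 1 k f" "multiple_below 1 k g"
  shows "multiple_below (of_nat CARD('p)) k
    ((f + g) ^ CARD('p) - f ^ CARD('p) - (g :: 'p::prime_card padic fps) ^ CARD('p))"
proof -
  let ?p = "CARD('p)"
  let ?t = "\<lambda>i. of_nat (?p choose i) * f ^ i * g ^ (?p - i)"
  have p: "prime ?p"
    by (rule prime_card)
  have split: "{..?p} = insert 0 (insert ?p {0<..<?p})"
    using prime_gt_0_nat[OF p] by auto
  have "(f + g) ^ ?p = g ^ ?p + (f ^ ?p + sum ?t {0<..<?p})"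
    unfolding binomial_ring split using prime_gt_0_nat[OF p] by simp
  then have eq: "(f + g) ^ ?p - f ^ ?p - g ^ ?p = sum ?t {0<..<?p}"
    by simp
  have "multiple_below (of_nat ?p) k (?t i)" if i: "i \<in> {0<..<?p}" for i
  proof -
    have "?p dvd (?p choose i)"
      using i p by (intro dvd_choose_prime) auto
    then obtain q where "?p choose i = ?p * q" ..
    then have "?t i = of_nat ?p * (of_nat q * f ^ i * g ^ (?p - i))"
      by (simp add: mult.assoc)
    moreover have "multiple_below (of_nat ?p) k \<dots>"
      by (intro multiple_below_of_nat_multI multiple_below_mult_integral multiple_below_of_nat
          multiple_below_power assms)
    ultimately show ?thesis
      by (simp only:)
  qed
  then show ?thesis
    unfolding eq by (rule multiple_below_sum)
qed

lemma multiple_below_1_plus_power_minus_1: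
  assumes "multiple_below c k f" "multiple_below 1 k f"
  shows "multiple_below c k ((1 + f) ^ m - 1)"
proof (induction m)
  case 0
  then show ?case by (simp add: multiple_below_0)
next
  case (Suc m)
  have "(1 + f) ^ Suc m - 1 = ((1 + f) ^ m - 1) + (1 + f) ^ m * f"
    by (simp add: algebra_simps)
  moreover have "multiple_below c k \<dots>"
    using assms by (intro multiple_below_add Suc.IH multiple_below_mult_integral
        multiple_below_power multiple_below_1)
  ultimately show ?case
    by (simp only:)
qed

text \<open>
  Modulo $p$ the $p$-th power map and $\<sigma>$ are both additive and agree on constants, by Fermat,
  and on $t$, as $t^\<sigma> \equiv t^p$; so monomials can be treated one by one.
\<close>

lemma multiple_below_power_minus_sigma:
  assumes u: "u \<in> integral_fps" and c: "\<And>i. c i \<in> padic_integers"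
  defines "P \<equiv> \<lambda>m. \<Sum>i<m. fps_const (c i) * fps_X ^ i"
  shows "multiple_below (of_nat CARD('p)) k
    (P m ^ CARD('p) - (P m oo t_sigma (u :: 'p::prime_card padic fps)))"
proof (induction m)
  case 0
  then show ?case
    using prime_gt_0_nat[OF prime_card[where 'a = 'p]]
    by (simp add: P_def zero_power multiple_below_0)
next
  case (Suc m)
  let ?p = "CARD('p)" and ?s = "t_sigma u"
  let ?M = "fps_const (c m) * fps_X ^ m"
  let ?V = "(1 + ptu u) ^ m"
  have int_P: "multiple_below 1 k (P m)" and int_M: "multiple_below 1 k ?M"
    unfolding P_def using c
    by (intro multiple_below_sum multiple_below_mult_integral multiple_below_const
        multiple_below_power multiple_below_X; simp)+
  have M_sigma: "?M oo ?s = fps_const (c m) * ?s ^ m"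
    by (simp add: fps_compose_mult_distrib fps_compose_power[symmetric] fps_X_fps_compose_startby0)
  have s_power: "?s ^ m = (fps_X ^ m) ^ ?p * ?V"
    unfolding t_sigma_def power_mult_distrib by (simp only: power_mult[symmetric] mult.commute)
  have M_power: "?M ^ ?p = (fps_X ^ m) ^ ?p * fps_const (c m ^ ?p)"
    by (simp only: power_mult_distrib fps_const_power mult.commute)
  have ring_identity: "X * a - b * (X * V) = X * ((a - b) + b * - (V - 1))" for X a b V :: "'p padic fps"
    by (simp add: algebra_simps)
  have eq_M: "?M ^ ?p - (?M oo ?s) =
      (fps_X ^ m) ^ ?p * (fps_const (c m ^ ?p - c m) + fps_const (c m) * - (?V - 1))"
    unfolding M_sigma s_power M_power fps_const_sub[symmetric] by (rule ring_identity)
  have "multiple_below (of_nat ?p) k (fps_const (c m ^ ?p - c m))"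
    using padic_fermat[OF c[of m]] by (auto simp: multiple_below_def intro: bexI[of _ 0])
  moreover have "multiple_below (of_nat ?p) k (?V - 1)"
    using u by (intro multiple_below_1_plus_power_minus_1 multiple_below_ptu
        multiple_below_of_nat_imp_integral[OF multiple_below_ptu])
  ultimately have "multiple_below (of_nat ?p) k (?M ^ ?p - (?M oo ?s))"
    unfolding eq_M using c
    by (intro multiple_below_mult_integral multiple_below_add multiple_below_power multiple_below_X
        multiple_below_const multiple_below_uminus)
  then have "multiple_below (of_nat ?p) k (((P m + ?M) ^ ?p - P m ^ ?p - ?M ^ ?p) +
      ((P m ^ ?p - (P m oo ?s)) + (?M ^ ?p - (?M oo ?s))))"
    by (intro multiple_below_add multiple_below_freshmans_dream int_P int_M Suc.IH)
  moreover have "P (Suc m) = P m + ?M"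
    by (simp add: P_def)
  ultimately show ?case
    by (simp add: fps_compose_add_distrib algebra_simps)
qed

lemma fps_exp_compose_add:
  fixes a b :: "'a::field_char_0 fps"
  assumes a: "fps_nth a 0 = 0" and b: "fps_nth b 0 = 0"
  shows "fps_exp 1 oo (a + b) = (fps_exp 1 oo a) * (fps_exp 1 oo b)"
proof -
  let ?E = "\<lambda>f. fps_exp (1 :: 'a) oo f"
  have deriv: "fps_deriv (?E f) = ?E f * fps_deriv f" if "fps_nth f 0 = 0" for f
    using that by (simp add: fps_compose_deriv)
  have const: "f = 1" if "fps_deriv f = 0" "fps_nth f 0 = 1" for f :: "'a fps"
    using that by (metis fps_const_1_eq_1 fps_deriv_eq_0_iff)
  have 1: "?E (- (a + b)) * ?E (a + b) = 1"
    using a b by (intro const) (simp_all add: deriv algebra_simps)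
  have 2: "?E (- (a + b)) * (?E a * ?E b) = 1"
    using a b by (intro const) (simp_all add: deriv algebra_simps)
  have "?E (a + b) = (?E (- (a + b)) * (?E a * ?E b)) * ?E (a + b)"
    unfolding 2 by simp
  also have "\<dots> = (?E (- (a + b)) * ?E (a + b)) * (?E a * ?E b)"
    by (simp only: ac_simps)
  finally show ?thesis
    unfolding 1 by simp
qed

lemma fps_exp_compose_of_nat_mult:
  fixes a :: "'a::field_char_0 fps"
  assumes "fps_nth a 0 = 0"
  shows "fps_exp 1 oo (of_nat m * a) = (fps_exp 1 oo a) ^ m"
  using assms by (induction m) (simp_all add: distrib_right fps_exp_compose_add)

text \<open>
  For \<open>E = exp g\<close> the hypothesis becomes \<open>E ^ p = E\<^sup>\<sigma> * exp (p h)\<close> with \<open>h\<close> integral, so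
  \<open>E ^ p\<close> and \<open>E\<^sup>\<sigma>\<close> agree modulo $p$ as far as \<open>E\<^sup>\<sigma>\<close> is integral. If \<open>E\<close> is integral
  below degree \<open>k\<close> and \<open>P\<close> is its truncation, then the coefficients of degree \<open>k\<close> of
  \<open>E ^ p\<close> and \<open>P ^ p\<close> differ by exactly \<open>p\<close> times the next coefficient of \<open>E\<close>, whereas those of
  \<open>E\<^sup>\<sigma>\<close> and \<open>P\<^sup>\<sigma>\<close> are equal. As \<open>P ^ p\<close> and \<open>P\<^sup>\<sigma>\<close> agree modulo $p$, this
  coefficient is integral.
\<close>

lemma dwork_exp_integral:
  fixes g u :: "'p::prime_card padic fps"
  assumes u: "u \<in> integral_fps" and g0: "fps_nth g 0 = 0"
    and g: "\<And>k. multiple_below (of_nat CARD('p)) k (of_nat CARD('p) * g - (g oo t_sigma u))"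
  shows "fps_exp 1 oo g \<in> integral_fps"
proof -
  let ?p = "CARD('p)" and ?s = "t_sigma u"
  define E where "E = fps_exp 1 oo g"
  have p2: "?p \<ge> 2"
    by (rule prime_ge_2_nat[OF prime_card])
  have p0: "?p > 0"
    by (rule prime_gt_0_nat[OF prime_card])
  define h where "h = fps_const (1 / of_nat ?p) * (of_nat ?p * g - (g oo ?s))"
  have h: "of_nat ?p * h = of_nat ?p * g - (g oo ?s)"
    unfolding h_def by (rule of_nat_mult_fps_const_inverse[OF p0])
  have int_h: "multiple_below 1 k h" for k
  proof (rule multiple_below_of_nat_multD[OF _ p0])
    show "multiple_below (of_nat ?p) k (of_nat ?p * h)"
      unfolding h by (rule g)
  qed
  have "of_nat ?p * h = fps_const (of_nat ?p) * h"
    by (simp only: fps_of_nat)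
  then have "of_nat ?p * fps_nth h 0 = fps_nth (of_nat ?p * h) 0"
    by (simp only: fps_mult_left_const_nth)
  also have "\<dots> = 0"
    unfolding h by (simp add: g0)
  finally have h0: "fps_nth h 0 = 0"
    using p0 by simp
  have E0: "fps_nth E 0 = 1"
    by (simp add: E_def)
  have "E ^ ?p = fps_exp 1 oo (of_nat ?p * g)"
    unfolding E_def by (rule fps_exp_compose_of_nat_mult[OF g0, symmetric])
  also have "of_nat ?p * g = (g oo ?s) + of_nat ?p * h"
    unfolding h by simp
  also have "fps_exp 1 oo \<dots> = (fps_exp 1 oo (g oo ?s)) * (fps_exp 1 oo (of_nat ?p * h))"
    by (rule fps_exp_compose_add) (simp_all add: g0 h0)
  also have "fps_exp 1 oo (g oo ?s) = E oo ?s"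
    unfolding E_def by (rule fps_compose_assoc[OF t_sigma_nth_0 g0])
  finally have "E ^ ?p - (E oo ?s) = (E oo ?s) * ((fps_exp 1 oo (of_nat ?p * h)) - 1)"
    by (simp only: right_diff_distrib mult_1_right)
  then have E_power: "multiple_below (of_nat ?p) k (E ^ ?p - (E oo ?s))" if "multiple_below 1 k (E oo ?s)" for k
    by (simp only: multiple_below_mult_integral[OF that multiple_below_exp_minus_1[OF int_h]])
  have "multiple_below 1 k E" for k
  proof (induction k)
    case 0
    then show ?case
      by (simp add: multiple_below_def)
  next
    case (Suc k)
    show ?case
    proof (cases "k = 0")
      case True
      then show ?thesis
        using E0 by (auto simp: multiple_below_def)
    next
      case False
      define c where "c = (\<lambda>i. if i < k then fps_nth E i else 0)"
      define P where "P = (\<Sum>i<k. fps_const (c i) * fps_X ^ i)"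
      have c: "c i \<in> padic_integers" for i
        using multiple_belowE[OF Suc.IH] unfolding c_def by (metis mult_1 padic_integers_0)
      have P_nth: "fps_nth P j = c j" for j
        unfolding P_def fps_sum_nth by (auto simp: c_def if_distrib cong: if_cong)
      define R where "R = fps_shift k (E - P)"
      have E_eq: "E - P = fps_X ^ k * R"
        by (rule fps_ext) (simp add: fps_X_power_mult_nth R_def P_nth c_def)
      have R0: "fps_nth R 0 = fps_nth E k"
        by (simp add: R_def P_nth c_def)
      have "E ^ ?p - P ^ ?p = fps_X ^ k * (R * (\<Sum>i<?p. P ^ (?p - Suc i) * E ^ i))"
        using power_diff_sumr2[of E ?p P] by (simp add: E_eq mult.assoc)
      then have "fps_nth (E ^ ?p - P ^ ?p) k = fps_nth R 0 * (\<Sum>i<?p. fps_nth P 0 ^ (?p - Suc i) * fps_nth E 0 ^ i)"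
        by (simp only: fps_X_power_mult_nth) (simp add: fps_sum_nth fps_nth_power_0)
      also have "\<dots> = of_nat ?p * fps_nth E k"
        using False by (simp add: R0 E0 P_nth c_def)
      finally have power_coeff: "fps_nth (E ^ ?p - P ^ ?p) k = of_nat ?p * fps_nth E k" .
      have "(E oo ?s) - (P oo ?s) = ?s ^ k * (R oo ?s)"
        by (simp add: E_eq fps_compose_mult_distrib fps_compose_power[symmetric]
            fps_X_fps_compose_startby0 flip: fps_compose_sub_distrib)
      also have "\<dots> = fps_X ^ (?p * k) * ((1 + ptu u) ^ k * (R oo ?s))"
        by (simp add: t_sigma_def power_mult_distrib power_mult mult.assoc)
      finally have sigma_coeff: "fps_nth ((E oo ?s) - (P oo ?s)) k = 0"
        using False p2 by (simp add: fps_X_power_mult_nth)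
      have "multiple_below 1 (Suc k) (E oo ?s)"
        using E0 by (intro multiple_below_sigma_gain u Suc.IH) (auto simp: multiple_below_def)
      then have "multiple_below (of_nat ?p) (Suc k) ((E ^ ?p - (E oo ?s)) - (P ^ ?p - (P oo ?s)))"
        unfolding P_def by (intro multiple_below_diff E_power multiple_below_power_minus_sigma u c)
      then obtain z where z: "z \<in> padic_integers"
          "fps_nth ((E ^ ?p - (E oo ?s)) - (P ^ ?p - (P oo ?s))) k = of_nat ?p * z"
        using multiple_belowE by blast
      then have "of_nat ?p * fps_nth E k = of_nat ?p * z"
        using power_coeff sigma_coeff by simp
      then have "fps_nth E k = z"
        using p0 by simp
      then show ?thesis
        using Suc.IH z(1) unfolding multiple_below_def by (auto simp: less_Suc_eq)
    qed
  qed
  then show ?thesis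
    by (simp add: integral_fps_iff_multiple_below E_def)
qed

section \<open>Differential operators on series without and with one logarithm\<close>

definition series_op :: "nat \<Rightarrow> (nat \<Rightarrow> 'p::prime_card padic fps) \<Rightarrow> 'p padic fps \<Rightarrow> 'p padic fps" where
  "series_op n A f = (\<Sum>i<n. A i * (fps_XD ^^ i) f)"

text \<open>
  On series with a logarithm \<open>\<A>(f log t) = \<A>(f) log t + \<A>'(f)\<close>, where \<open>\<A>'\<close> is the formal
  derivative of \<open>\<A>\<close> with respect to \<open>\<theta>\<close>.
\<close>

definition series_op_deriv :: "nat \<Rightarrow> (nat \<Rightarrow> 'p::prime_card padic fps) \<Rightarrow> 'p padic fps \<Rightarrow> 'p padic fps" where
  "series_op_deriv n A f = (\<Sum>i<n. A i * (of_nat i * (fps_XD ^^ (i - 1)) f))"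

lemma fps_XD_0: "fps_XD 0 = (0 :: 'a::comm_ring_1 fps)"
  by (rule fps_ext) simp

lemma fps_XD_diff: "fps_XD (f - g) = fps_XD f - fps_XD (g :: 'a::comm_ring_1 fps)"
  by (rule fps_ext) (simp add: algebra_simps)

lemma fps_XD_of_nat_mult: "fps_XD (of_nat m * f) = of_nat m * fps_XD (f :: 'a::comm_ring_1 fps)"
  by (simp add: fps_of_nat[symmetric])

lemma fps_XD_iterate_nth: "fps_nth ((fps_XD ^^ i) f) j = of_nat j ^ i * fps_nth (f :: 'a::comm_ring_1 fps) j"
  by (simp add: fps_mult_fps_XD_shift)

lemma fps_XD_iterate_0: "(fps_XD ^^ i) 0 = (0 :: 'a::comm_ring_1 fps)"
  by (rule fps_ext) (simp add: fps_XD_iterate_nth)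

lemma fps_XD_iterate_add: "(fps_XD ^^ i) (f + g) = (fps_XD ^^ i) f + (fps_XD ^^ i) (g :: 'a::comm_ring_1 fps)"
  by (rule fps_ext) (simp add: fps_XD_iterate_nth algebra_simps)

lemma fps_XD_iterate_of_nat_mult:
  "(fps_XD ^^ i) (of_nat m * f) = of_nat m * (fps_XD ^^ i) (f :: 'a::comm_ring_1 fps)"
  by (induction i) (simp_all add: fps_XD_of_nat_mult)

lemma series_op_add: "series_op n A (f + g) = series_op n A f + series_op n A g"
  by (simp add: series_op_def fps_XD_iterate_add distrib_left sum.distrib)

lemma series_op_of_nat_mult: "series_op n A (of_nat m * f) = of_nat m * series_op n A f"
  by (simp add: series_op_def fps_XD_iterate_of_nat_mult sum_distrib_left mult.left_commute)

lemma series_op_deriv_of_nat_mult: "series_op_deriv n A (of_nat m * f) = of_nat m * series_op_deriv n A f"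
  by (simp add: series_op_deriv_def fps_XD_iterate_of_nat_mult sum_distrib_left mult.left_commute)

lemma series_op_nth_0:
  assumes "n > 0"
  shows "fps_nth (series_op n A f) 0 = fps_nth (A 0) 0 * fps_nth f 0"
proof -
  have "fps_nth (series_op n A f) 0 = (\<Sum>i<n. if i = 0 then fps_nth (A 0) 0 * fps_nth f 0 else 0)"
    unfolding series_op_def fps_sum_nth by (intro sum.cong) (auto simp: fps_XD_iterate_nth zero_power)
  then show ?thesis
    using assms by simp
qed

lemma multiple_below_series_op:
  assumes "\<And>i. i < n \<Longrightarrow> A i \<in> integral_fps" "multiple_below c k f"
  shows "multiple_below c k (series_op n A f)"
  unfolding series_op_def using assms
  by (intro multiple_below_sum multiple_below_mult_integral multiple_below_integral_fps
      multiple_below_XD_iterate) auto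

lemma multiple_below_series_op_deriv:
  assumes "\<And>i. i < n \<Longrightarrow> A i \<in> integral_fps" "multiple_below c k f"
  shows "multiple_below c k (series_op_deriv n A f)"
  unfolding series_op_deriv_def using assms
  by (intro multiple_below_sum multiple_below_mult_integral multiple_below_integral_fps
      multiple_below_XD_iterate multiple_below_of_nat) auto

text \<open>
  A series whose derivative vanishes modulo \<open>c\<close> is a constant for the purposes of a differential
  operator modulo \<open>c\<close>, even if the series itself has denominators.
\<close>

lemma multiple_below_series_op_mult:
  assumes A: "\<And>i. i < n \<Longrightarrow> A i \<in> integral_fps"
    and f: "multiple_below 1 k f" and h: "multiple_below c k (fps_XD h)"
  shows "multiple_below c k (series_op n A (f * h) - h * series_op n A f)"
proof -
  have iterate: "multiple_below c k ((fps_XD ^^ i) (f * h) - h * (fps_XD ^^ i) f)" for i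
  proof (induction i)
    case 0
    then show ?case
      by (simp add: multiple_below_0 mult.commute)
  next
    case (Suc i)
    let ?d = "(fps_XD ^^ i) (f * h) - h * (fps_XD ^^ i) f"
    have "fps_XD ?d = (fps_XD ^^ Suc i) (f * h) - h * (fps_XD ^^ Suc i) f - (fps_XD ^^ i) f * fps_XD h"
      by (simp add: fps_XD_diff fps_XD_mult algebra_simps)
    then have "(fps_XD ^^ Suc i) (f * h) - h * (fps_XD ^^ Suc i) f =
        fps_XD ?d + (fps_XD ^^ i) f * fps_XD h"
      by simp
    moreover have "multiple_below c k \<dots>"
      by (intro multiple_below_add multiple_below_XD Suc.IH multiple_below_mult_integral
          multiple_below_XD_iterate f h)
    ultimately show ?case
      by (simp only:)
  qed
  have "series_op n A (f * h) - h * series_op n A f =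
      (\<Sum>i<n. A i * ((fps_XD ^^ i) (f * h) - h * (fps_XD ^^ i) f))"
    by (simp add: series_op_def sum_distrib_left right_diff_distrib mult.left_commute sum_subtractf)
  also have "multiple_below c k \<dots>"
    using A by (intro multiple_below_sum multiple_below_mult_integral multiple_below_integral_fps iterate) auto
  finally show ?thesis .
qed

lemma coeff_theta: "coeff (theta y) i = fps_XD (coeff y i) + of_nat (Suc i) * coeff y (Suc i)"
  by (simp add: theta_def coeff_map_poly coeff_pderiv fps_XD_0)

lemma theta_diff_smult_const:
  "theta (y - smult (fps_const c) z) = theta y - smult (fps_const c) (theta z)"
  by (rule poly_eqI) (simp add: coeff_theta fps_XD_diff algebra_simps)

lemma is_solution_diff_smult_const:
  assumes "is_solution n a y" "is_solution n a z"
  shows "is_solution n a (y - smult (fps_const c) z)"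
proof -
  have iterate: "(theta ^^ i) (y - smult (fps_const c) z) = (theta ^^ i) y - smult (fps_const c) ((theta ^^ i) z)" for i
    by (induction i) (simp_all add: theta_diff_smult_const)
  have "monic_diff_op n a (y - smult (fps_const c) z) =
      monic_diff_op n a y - smult (fps_const c) (monic_diff_op n a z)"
    by (simp add: monic_diff_op_def diff_op_def iterate smult_diff_right smult_add_right
        sum_subtractf smult_sum2 mult.commute)
  then show ?thesis
    using assms by (simp add: is_solution_def)
qed

lemma theta_iterate_linear:
  "(theta ^^ i) [:f, g:] = [:(fps_XD ^^ i) f + of_nat i * (fps_XD ^^ (i - 1)) g, (fps_XD ^^ i) g:]"
proof (induction i)
  case (Suc i)
  have "theta [:f', g':] = [:fps_XD f' + g', fps_XD g':]" for f' g' :: "'a padic fps"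
    by (rule poly_eqI) (simp add: coeff_theta coeff_pCons fps_XD_0 split: nat.split)
  then show ?case
    using Suc.IH by (cases i) (simp_all add: fps_XD_of_nat_mult algebra_simps)
qed simp

lemma diff_op_linear:
  "diff_op n A [:f, g:] = [:series_op n A f + series_op_deriv n A g, series_op n A g:]"
proof -
  have sum_linear: "(\<Sum>i<n. [:x i, y i:]) = [:\<Sum>i<n. x i, \<Sum>i<n. y i:]" for x y :: "nat \<Rightarrow> 'a padic fps"
    by (induction n) simp_all
  show ?thesis
    by (simp add: diff_op_def theta_iterate_linear sum_linear series_op_def series_op_deriv_def
        sum.distrib distrib_left)
qed

lemma frobenius_lift_linear:
  "frobenius_lift u [:f, g:] =
    [:(f oo t_sigma u) + (g oo t_sigma u) * (fps_ln 1 oo ptu u), of_nat CARD('p) * (g oo t_sigma u):]"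
  for f :: "'p::prime_card padic fps"
proof -
  have "log_t_sigma u = [:fps_ln 1 oo ptu u, of_nat CARD('p):]"
    by (simp add: log_t_sigma_def log_t_def of_nat_poly)
  moreover have "map_poly (\<lambda>f. f oo t_sigma u) [:f, g:] = [:f oo t_sigma u, g oo t_sigma u:]"
    by (rule poly_eqI) (simp add: coeff_map_poly coeff_pCons split: nat.split)
  ultimately show ?thesis
    by (simp add: frobenius_lift_def pcompose_pCons mult.commute)
qed

lemma log_solution_0: "log_solution F 0 = [:F 0:]"
  by (simp add: log_solution_def)

lemma log_solution_1: "log_solution F 1 = [:F 1, F 0:]"
  by (simp add: log_solution_def log_t_def)

text \<open>
  Because all \<open>a i\<close> vanish at \<open>0\<close>, the lowest term $c\,t^j$ of a solution satisfies \<open>j ^ n * c = 0\<close>.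
\<close>

lemma solution_series_eq_0:
  assumes a: "\<And>i. i < n \<Longrightarrow> fps_nth (a i) 0 = 0"
    and f: "is_solution n a [:f:]" "fps_nth f 0 = 0"
  shows "f = 0"
proof (rule fps_ext)
  have eq: "(fps_XD ^^ n) f + series_op n a f = 0"
    using f(1) theta_iterate_linear[of n f 0] diff_op_linear[of n a f 0]
    by (simp add: is_solution_def monic_diff_op_def fps_XD_iterate_0 series_op_deriv_def)
  fix j
  show "fps_nth f j = fps_nth 0 j"
  proof (induction j rule: less_induct)
    case (less j)
    show ?case
    proof (cases "j = 0")
      case False
      have "fps_nth (a i * (fps_XD ^^ i) f) j = 0" if "i < n" for i
        unfolding fps_mult_nth
      proof (intro sum.neutral ballI)
        fix l assume "l \<in> {0..j}"
        then show "fps_nth (a i) l * fps_nth ((fps_XD ^^ i) f) (j - l) = 0"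
          using a[OF that] less[of "j - l"] by (cases "l = 0") (auto simp: fps_XD_iterate_nth)
      qed
      then have "fps_nth (series_op n a f) j = 0"
        by (simp add: series_op_def fps_sum_nth)
      then have "of_nat j ^ n * fps_nth f j = 0"
        using arg_cong[OF eq, of "\<lambda>f. fps_nth f j"] by (simp add: fps_XD_iterate_nth)
      with False show ?thesis
        by simp
    qed (simp add: f(2))
  qed
qed

lemma solution_series_unique:
  assumes a: "\<And>i. i < n \<Longrightarrow> fps_nth (a i) 0 = 0"
    and f: "is_solution n a [:f:]" and g: "is_solution n a [:g:]" "fps_nth g 0 = 1"
  shows "f = fps_const (fps_nth f 0) * g"
proof -
  have "is_solution n a [:f - fps_const (fps_nth f 0) * g:]"
    using is_solution_diff_smult_const[OF f g(1), of "fps_nth f 0"] by simp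
  then have "f - fps_const (fps_nth f 0) * g = 0"
    using g(2) by (intro solution_series_eq_0[OF a]) auto
  then show ?thesis
    by simp
qed


section \<open>The Frobenius structure on the first two solutions\<close>

locale frobenius_structure =
  fixes u :: "'p::prime_card padic fps" and n :: nat and a F A :: "nat \<Rightarrow> 'p padic fps"
  assumes n: "n \<ge> 2"
    and a_0: "\<And>i. i < n \<Longrightarrow> fps_nth (a i) 0 = 0"
    and u: "u \<in> integral_fps"
    and F: "standard_basis n a F"
    and A: "\<And>i. i < n \<Longrightarrow> A i \<in> integral_fps"
    and A_0: "fps_nth (A 0) 0 = 1"
    and frobenius: "\<And>y. is_solution n a y \<Longrightarrow> is_solution n a (diff_op n A (frobenius_lift u y))"
begin

abbreviation sigma :: "'p padic fps \<Rightarrow> 'p padic fps" where "sigma f \<equiv> f oo t_sigma u"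

lemma solution_F0: "is_solution n a [:F 0:]" and solution_F1: "is_solution n a [:F 1, F 0:]"
proof -
  have "is_solution n a (log_solution F i)" if "i < n" for i
    using F that by (simp add: standard_basis_def)
  from this[of 0] this[of 1] show "is_solution n a [:F 0:]" "is_solution n a [:F 1, F 0:]"
    using n by (simp_all only: log_solution_0 log_solution_1)
qed

lemma F0_nth_0: "fps_nth (F 0) 0 = 1" and F1_nth_0: "fps_nth (F 1) 0 = 0"
  using F n by (auto simp: standard_basis_def)

lemma frobenius_F0: "series_op n A (sigma (F 0)) = F 0"
proof -
  have "is_solution n a [:series_op n A (sigma (F 0)):]"
    using frobenius[OF solution_F0] frobenius_lift_linear[of u "F 0" 0]
      diff_op_linear[of n A "sigma (F 0)" 0]
    by (simp add: series_op_def series_op_deriv_def fps_XD_iterate_0)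
  from solution_series_unique[OF a_0 this solution_F0 F0_nth_0]
  show ?thesis
    using n by (simp add: series_op_nth_0 A_0 F0_nth_0)
qed

text \<open>
  Only coefficients of lower degree of \<open>F 0\<close> enter on the left of \<open>\<A>(F\<^sub>0\<^sup>\<sigma>) = F\<^sub>0\<close>, so integrality
  propagates.
\<close>

lemma F0_integral: "multiple_below 1 k (F 0)"
proof (induction k)
  case 0
  then show ?case
    by (simp add: multiple_below_def)
next
  case (Suc k)
  have "multiple_below 1 1 (F 0)"
    using F0_nth_0 by (auto simp: multiple_below_def)
  then have "multiple_below 1 (Suc k) (series_op n A (sigma (F 0)))"
    by (intro multiple_below_series_op A multiple_below_sigma_gain u Suc.IH)
  then show ?case
    by (simp only: frobenius_F0)
qed

text \<open>
  The solution \<open>\<A>(y\<^sub>1\<^sup>\<sigma>)\<close> has the same logarithmic part as \<open>p y\<^sub>1\<close>, so it differs from it by a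
  multiple \<open>c y\<^sub>0\<close>. The constant \<open>c\<close> is the value at \<open>t = 0\<close> of the part of \<open>\<A>(y\<^sub>1\<^sup>\<sigma>)\<close> free of
  logarithms, to which \<open>F\<^sub>1\<^sup>\<sigma>\<close> and $\log(t^\<sigma>/t^p)$ contribute nothing; what remains comes from
  $p\log t$ and is divisible by \<open>p\<close>.
\<close>

lemma frobenius_F1: "multiple_below (of_nat CARD('p)) k (of_nat CARD('p) * F 1 - series_op n A (sigma (F 1)))"
proof -
  let ?l = "fps_ln 1 oo ptu u"
  define K where "K = series_op_deriv n A (sigma (F 0))"
  define L where "L = series_op n A (sigma (F 0) * ?l)"
  define b where "b = series_op n A (sigma (F 1)) + L + of_nat CARD('p) * K"
  have "is_solution n a [:b, of_nat CARD('p) * F 0:]"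
    using frobenius[OF solution_F1]
    unfolding frobenius_lift_linear diff_op_linear series_op_add series_op_of_nat_mult
      series_op_deriv_of_nat_mult frobenius_F0 b_def K_def L_def .
  from is_solution_diff_smult_const[OF this solution_F1, of "of_nat CARD('p)"]
  have "is_solution n a [:b - of_nat CARD('p) * F 1:]"
    by (simp add: fps_of_nat)
  from solution_series_unique[OF a_0 this solution_F0 F0_nth_0]
  have "b - of_nat CARD('p) * F 1 = fps_const (fps_nth (b - of_nat CARD('p) * F 1) 0) * F 0"
    by blast
  also have "fps_nth (b - of_nat CARD('p) * F 1) 0 = of_nat CARD('p) * fps_nth K 0"
    using n F1_nth_0 unfolding b_def L_def
    by (simp add: series_op_nth_0)
  finally have "of_nat CARD('p) * F 1 - series_op n A (sigma (F 1)) =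
      L + of_nat CARD('p) * K - of_nat CARD('p) * (fps_const (fps_nth K 0) * F 0)"
    unfolding b_def by (simp add: algebra_simps fps_of_nat flip: fps_const_mult)
  moreover have "multiple_below (of_nat CARD('p)) k L"
  proof -
    have ln: "multiple_below (of_nat CARD('p)) k ?l"
      unfolding ptu_def mult.assoc
      by (intro multiple_below_ln multiple_below_mult_integral multiple_below_X
          multiple_below_integral_fps u)
    show ?thesis
      unfolding L_def
      by (intro multiple_below_series_op A multiple_below_mult_integral[OF _ ln]
          multiple_below_compose F0_integral multiple_below_t_sigma u)
  qed
  moreover have int_K: "multiple_below 1 l K" for l
    unfolding K_def
    by (intro multiple_below_series_op_deriv A multiple_below_compose F0_integral
        multiple_below_t_sigma u)
  moreover have "fps_nth K 0 \<in> padic_integers"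
    using int_K[of 1] by (auto simp: multiple_below_def)
  ultimately show ?thesis
    by (simp only:) (intro multiple_below_add multiple_below_diff multiple_below_of_nat_multI
        multiple_below_mult_integral multiple_below_const F0_integral)
qed

abbreviation g :: "'p padic fps" where "g \<equiv> F 1 / F 0"

lemma F0_mult_g: "F 0 * g = F 1"
  using F0_nth_0 by (simp add: fps_divide_unit mult.left_commute[of "F 0"] inverse_mult_eq_1')

lemma g_nth_0: "fps_nth g 0 = 0"
  using arg_cong[OF F0_mult_g, of "\<lambda>f. fps_nth f 0"] by (simp add: F0_nth_0 F1_nth_0 del: One_nat_def)

text \<open>
  Modulo \<open>p\<close> the operator \<open>\<A>\<close> treats \<open>g\<^sup>\<sigma>\<close> as a constant once \<open>\<theta>(g)\<close> is known to be integral,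
  so \<open>p F\<^sub>1 \<equiv> \<A>(F\<^sub>1\<^sup>\<sigma>) = \<A>(F\<^sub>0\<^sup>\<sigma> g\<^sup>\<sigma>) \<equiv> g\<^sup>\<sigma> \<A>(F\<^sub>0\<^sup>\<sigma>) = g\<^sup>\<sigma> F\<^sub>0\<close>.
\<close>

lemma g_congruence:
  assumes "multiple_below 1 k (fps_XD g)"
  shows "multiple_below (of_nat CARD('p)) (Suc k) (of_nat CARD('p) * g - sigma g)"
proof -
  have "sigma (F 1) = sigma (F 0) * sigma g"
    by (simp add: F0_mult_g del: One_nat_def flip: fps_compose_mult_distrib)
  then have "F 0 * (of_nat CARD('p) * g - sigma g) =
      (of_nat CARD('p) * F 1 - series_op n A (sigma (F 1))) +
      (series_op n A (sigma (F 0) * sigma g) - sigma g * series_op n A (sigma (F 0)))"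
    by (simp add: frobenius_F0 right_diff_distrib mult.left_commute F0_mult_g mult.commute[of "F 0" "sigma g"]
        del: One_nat_def)
  moreover have "multiple_below (of_nat CARD('p)) (Suc k) \<dots>"
    by (intro multiple_below_add frobenius_F1 multiple_below_series_op_mult A
        multiple_below_compose F0_integral multiple_below_t_sigma multiple_below_XD_sigma_gain u assms)
  ultimately have "multiple_below (of_nat CARD('p)) (Suc k) (F 0 * (of_nat CARD('p) * g - sigma g))"
    by (simp only:)
  then show ?thesis
    by (rule multiple_below_cancel_factor[OF F0_integral F0_nth_0])
qed

lemma XD_g_integral: "multiple_below 1 k (fps_XD g)"
proof (induction k)
  case 0
  then show ?case
    by (simp add: multiple_below_def)
next
  case (Suc k)
  have "of_nat CARD('p) * fps_XD g = fps_XD (of_nat CARD('p) * g - sigma g) + fps_XD (sigma g)"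
    by (simp only: fps_XD_diff fps_XD_of_nat_mult diff_add_cancel)
  moreover have "multiple_below (of_nat CARD('p)) (Suc k) \<dots>"
    by (intro multiple_below_add multiple_below_XD g_congruence multiple_below_XD_sigma_gain u Suc.IH)
  ultimately have "multiple_below (of_nat CARD('p)) (Suc k) (of_nat CARD('p) * fps_XD g)"
    by (simp only:)
  then show ?case
    by (rule multiple_below_of_nat_multD) (rule prime_gt_0_nat[OF prime_card])
qed

lemma exp_g_integral: "fps_exp 1 oo g \<in> integral_fps"
  by (rule dwork_exp_integral[OF u g_nth_0])
    (rule multiple_below_mono[OF g_congruence[OF XD_g_integral] le_SucI[OF order_refl]])

end

theorem theorem1p4:
  fixes n :: nat
    and a F :: "nat \<Rightarrow> 'p::prime_card padic fps"
    and u :: "'p padic fps"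
  assumes "odd CARD('p)"
    and "n \<ge> 2"
    and "\<And>i. i < n \<Longrightarrow> a i \<in> integral_fps"
    and "\<And>i. i < n \<Longrightarrow> fps_nth (a i) 0 = 0"
    and "u \<in> integral_fps"
    and "standard_basis n a F"
    and "has_frobenius_structure u n a"
  shows "fps_exp 1 oo (F 1 / F 0) \<in> integral_fps"
proof -
  obtain A where "\<And>i. i < n \<Longrightarrow> A i \<in> integral_fps" "fps_nth (A 0) 0 = 1"
      "\<And>y. is_solution n a y \<Longrightarrow> is_solution n a (diff_op n A (frobenius_lift u y))"
    using assms(7) unfolding has_frobenius_structure_def by blast
  with assms interpret frobenius_structure u n a F A
    by unfold_locales
  show ?thesis
    by (rule exp_g_integral)
qed

end
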